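(* Let $\Bbbk$ be a field of characteristic zero and let $A$ be a graded Poisson algebra $\Bbbk[x_1,\ldots,x_n]$ with $\deg x_i>0$ for all $i$. (1) If $A$ is unimodular, then $Gspd(A)=Gpd(A)$. (2) If $B$ is a twist of $A$, then $Gspd(A)=Gspd(B)$. (3) $Gspd(A)$ is a finite-dimensional Lie algebra (under the commutator bracket of derivations).
   Context: A graded Poisson algebra here is $\Bbbk[x_1,\ldots,x_n]$, $\mathbb{Z}$-graded with each $x_i$ homogeneous, with a Poisson bracket such that $\deg\{a,b\}=\deg a+\deg b$ for homogeneous $a,b$. For homogeneous $a$, $|a|=\deg a$; the Euler derivation is $E(a)=|a|\,a$. For a derivation $\delta$ and homogeneous $a,b,c$ put $$\begin{aligned}p(\{-,-\},\delta;a,b,c)=\;&|a|a\,[\delta(\{b,c\})-\{\delta(b),c\}-\{b,\delta(c)\}]\\&-|b|b\,[\delta(\{a,c\})-\{\delta(a),c\}-\{a,\delta(c)\}]\\&+|c|c\,[\delta(\{a,b\})-\{\delta(a),b\}-\{a,\delta(b)\}].\end{aligned}$$ A derivation $\delta$ is semi-Poisson if $p(\{-,-\},\delta;a,b,c)=0$ for all homogeneous $a,b,c$; it is Poisson if $\delta(\{a,b\})=\{\delta(a),b\}+\{a,\delta(b)\}$ for all $a,b$. $Gspd(A)$ (resp. $Gpd(A)$) denotes the set of graded semi-Poisson (resp. graded Poisson) derivations of $A$ of degree $0$. A (graded) twist of $A$ is the Poisson algebra $A^{\delta}$, for some $\delta\in Gspd(A)$, which is the same graded commutative algebra with Poisson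 bracket $\{a,b\}_{new}=\{a,b\}+E(a)\delta(b)-\delta(a)E(b)$. The divergence of a derivation is $\operatorname{div}(\delta)=\sum_i\frac{\partial\delta(x_i)}{\partial x_i}$; the modular derivation is ${\mathbf m}(a)=-\operatorname{div}(\{a,-\})$; $A$ is unimodular if ${\mathbf m}=0$. *)

theory Defs
  imports Complex_Main "HOL-Library.Poly_Mapping" "HOL-Library.Function_Algebras"
begin

section \<open>The graded polynomial ring\<close>

text \<open>
  Polynomials over \<open>'k\<close> in the variables \<open>x\<^sub>i\<close>, where \<open>i\<close> ranges over the finite index type
  \<open>'n\<close>: finitely supported maps from exponent vectors to coefficients, whose ring structure is
  the convolution product of \<open>HOL-Library.Poly_Mapping\<close>.
\<close>

type_synonym ('n, 'k) mpol = "('n \<Rightarrow>\<^sub>0 nat) \<Rightarrow>\<^sub>0 'k"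

definition var :: "'n \<Rightarrow> ('n, 'k::field_char_0) mpol" where
  "var i = Poly_Mapping.single (Poly_Mapping.single i 1) 1"

definition pscale :: "'k::field_char_0 \<Rightarrow> ('n, 'k) mpol \<Rightarrow> ('n, 'k) mpol" where
  "pscale c a = Poly_Mapping.single 0 c * a"

text \<open>The truncated subtraction of exponents is harmless: if \<open>x\<^sub>i\<close> does not occur in the
  monomial \<open>m\<close>, then the coefficient of the corresponding summand is \<open>0\<close>.\<close>

definition partial_deriv :: "'n \<Rightarrow> ('n, 'k::field_char_0) mpol \<Rightarrow> ('n, 'k) mpol" where
  "partial_deriv i a =
     (\<Sum>m\<in>Poly_Mapping.keys a.
        Poly_Mapping.single (m - Poly_Mapping.single i 1)
          (of_nat (Poly_Mapping.lookup m i) * Poly_Mapping.lookup a m))"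

text \<open>A \<open>\<int>\<close>-grading with homogeneous variables is given by the weights \<open>w i = deg x\<^sub>i\<close>.\<close>

definition mdeg :: "('n::finite \<Rightarrow> int) \<Rightarrow> ('n \<Rightarrow>\<^sub>0 nat) \<Rightarrow> int" where
  "mdeg w m = (\<Sum>i\<in>UNIV. int (Poly_Mapping.lookup m i) * w i)"

text \<open>The zero polynomial is homogeneous of every degree.\<close>

definition homogeneous_of :: "('n::finite \<Rightarrow> int) \<Rightarrow> int \<Rightarrow> ('n, 'k::field_char_0) mpol \<Rightarrow> bool" where
  "homogeneous_of w d a \<longleftrightarrow> (\<forall>m\<in>Poly_Mapping.keys a. mdeg w m = d)"

definition homogeneous :: "('n::finite \<Rightarrow> int) \<Rightarrow> ('n, 'k::field_char_0) mpol \<Rightarrow> bool" where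
  "homogeneous w a \<longleftrightarrow> (\<exists>d. homogeneous_of w d a)"

text \<open>The degree \<open>\<bar>a\<bar>\<close> is used only for homogeneous \<open>a\<close>, and only in products \<open>\<bar>a\<bar> a\<close>, so that
  the value chosen at \<open>0\<close> is irrelevant.\<close>

definition hdeg :: "('n::finite \<Rightarrow> int) \<Rightarrow> ('n, 'k::field_char_0) mpol \<Rightarrow> int" where
  "hdeg w a = (if a = 0 then 0 else (THE d. homogeneous_of w d a))"

lemma hdeg_eq: "homogeneous_of w d a \<Longrightarrow> a \<noteq> 0 \<Longrightarrow> hdeg w a = d"
  unfolding hdeg_def homogeneous_of_def by (auto intro!: the_equality)

text \<open>The linear extension of \<open>a \<mapsto> \<bar>a\<bar> a\<close> from homogeneous elements to all polynomials.\<close>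

definition euler :: "('n::finite \<Rightarrow> int) \<Rightarrow> ('n, 'k::field_char_0) mpol \<Rightarrow> ('n, 'k) mpol" where
  "euler w a = Poly_Mapping.mapp (\<lambda>m c. of_int (mdeg w m) * c) a"

lemma euler_homogeneous:
  assumes "homogeneous w a"
  shows "euler w a = of_int (hdeg w a) * a"
proof (cases "a = 0")
  case True
  then show ?thesis by (auto simp: euler_def intro!: poly_mapping_eqI simp: lookup_mapp)
next
  case False
  have deg: "mdeg w m = hdeg w a" if "m \<in> Poly_Mapping.keys a" for m
    using assms False hdeg_eq that by (metis homogeneous_def homogeneous_of_def)
  have "of_int (hdeg w a) * a = Poly_Mapping.map ((*) (of_int (hdeg w a))) a"
    by (simp add: mult_map_scale_conv_mult)
  with deg show ?thesis
    by (auto simp: euler_def lookup_mapp Poly_Mapping.map.rep_eq in_keys_iff when_def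
        intro!: poly_mapping_eqI)
qed

section \<open>Derivations and Poisson brackets\<close>

definition derivation :: "(('n, 'k::field_char_0) mpol \<Rightarrow> ('n, 'k) mpol) \<Rightarrow> bool" where
  "derivation \<delta> \<longleftrightarrow> Vector_Spaces.linear pscale pscale \<delta> \<and>
     (\<forall>a b. \<delta> (a * b) = \<delta> a * b + a * \<delta> b)"

definition graded_deg0 ::
    "('n::finite \<Rightarrow> int) \<Rightarrow> (('n, 'k::field_char_0) mpol \<Rightarrow> ('n, 'k) mpol) \<Rightarrow> bool" where
  "graded_deg0 w \<delta> \<longleftrightarrow> (\<forall>d a. homogeneous_of w d a \<longrightarrow> homogeneous_of w d (\<delta> a))"

type_synonym ('n, 'k) bracket = "('n, 'k) mpol \<Rightarrow> ('n, 'k) mpol \<Rightarrow> ('n, 'k) mpol"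

definition Poisson_bracket :: "('n, 'k::field_char_0) bracket \<Rightarrow> bool" where
  "Poisson_bracket br \<longleftrightarrow>
     (\<forall>a. derivation (br a)) \<and> (\<forall>b. derivation (\<lambda>a. br a b)) \<and>
     (\<forall>a. br a a = 0) \<and>
     (\<forall>a b c. br a (br b c) + br b (br c a) + br c (br a b) = 0)"

definition graded_Poisson_algebra ::
    "('n::finite \<Rightarrow> int) \<Rightarrow> ('n, 'k::field_char_0) bracket \<Rightarrow> bool" where
  "graded_Poisson_algebra w br \<longleftrightarrow> Poisson_bracket br \<and>
     (\<forall>d e a b. homogeneous_of w d a \<longrightarrow> homogeneous_of w e b \<longrightarrow>
        homogeneous_of w (d + e) (br a b))"

definition divergence :: "(('n::finite, 'k::field_char_0) mpol \<Rightarrow> ('n, 'k) mpol) \<Rightarrow> ('n, 'k) mpol" where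
  "divergence \<delta> = (\<Sum>i\<in>UNIV. partial_deriv i (\<delta> (var i)))"

definition modular_derivation ::
    "('n::finite, 'k::field_char_0) bracket \<Rightarrow> ('n, 'k) mpol \<Rightarrow> ('n, 'k) mpol" where
  "modular_derivation br a = - divergence (br a)"

definition unimodular :: "('n::finite, 'k::field_char_0) bracket \<Rightarrow> bool" where
  "unimodular br \<longleftrightarrow> (\<forall>a. modular_derivation br a = 0)"

section \<open>Semi-Poisson derivations and twists\<close>

definition p_form ::
    "('n::finite \<Rightarrow> int) \<Rightarrow> ('n, 'k::field_char_0) bracket \<Rightarrow> (('n, 'k) mpol \<Rightarrow> ('n, 'k) mpol) \<Rightarrow>
     ('n, 'k) mpol \<Rightarrow> ('n, 'k) mpol \<Rightarrow> ('n, 'k) mpol \<Rightarrow> ('n, 'k) mpol" where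
  "p_form w br \<delta> a b c =
       of_int (hdeg w a) * a * (\<delta> (br b c) - br (\<delta> b) c - br b (\<delta> c))
     - of_int (hdeg w b) * b * (\<delta> (br a c) - br (\<delta> a) c - br a (\<delta> c))
     + of_int (hdeg w c) * c * (\<delta> (br a b) - br (\<delta> a) b - br a (\<delta> b))"

definition semi_Poisson ::
    "('n::finite \<Rightarrow> int) \<Rightarrow> ('n, 'k::field_char_0) bracket \<Rightarrow>
     (('n, 'k) mpol \<Rightarrow> ('n, 'k) mpol) \<Rightarrow> bool" where
  "semi_Poisson w br \<delta> \<longleftrightarrow>
     (\<forall>a b c. homogeneous w a \<longrightarrow> homogeneous w b \<longrightarrow> homogeneous w c \<longrightarrow>
        p_form w br \<delta> a b c = 0)"

definition Poisson_derivation ::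
    "('n, 'k::field_char_0) bracket \<Rightarrow> (('n, 'k) mpol \<Rightarrow> ('n, 'k) mpol) \<Rightarrow> bool" where
  "Poisson_derivation br \<delta> \<longleftrightarrow> (\<forall>a b. \<delta> (br a b) = br (\<delta> a) b + br a (\<delta> b))"

definition Gspd ::
    "('n::finite \<Rightarrow> int) \<Rightarrow> ('n, 'k::field_char_0) bracket \<Rightarrow>
     (('n, 'k) mpol \<Rightarrow> ('n, 'k) mpol) set" where
  "Gspd w br = {\<delta>. derivation \<delta> \<and> graded_deg0 w \<delta> \<and> semi_Poisson w br \<delta>}"

definition Gpd ::
    "('n::finite \<Rightarrow> int) \<Rightarrow> ('n, 'k::field_char_0) bracket \<Rightarrow>
     (('n, 'k) mpol \<Rightarrow> ('n, 'k) mpol) set" where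
  "Gpd w br = {\<delta>. derivation \<delta> \<and> graded_deg0 w \<delta> \<and> Poisson_derivation br \<delta>}"

definition twist ::
    "('n::finite \<Rightarrow> int) \<Rightarrow> ('n, 'k::field_char_0) bracket \<Rightarrow> (('n, 'k) mpol \<Rightarrow> ('n, 'k) mpol) \<Rightarrow>
     ('n, 'k) bracket" where
  "twist w br \<delta> = (\<lambda>a b. br a b + euler w a * \<delta> b - \<delta> a * euler w b)"

text \<open>A twist has the same underlying graded algebra, so only the bracket varies.\<close>

definition is_twist ::
    "('n::finite \<Rightarrow> int) \<Rightarrow> ('n, 'k::field_char_0) bracket \<Rightarrow> ('n, 'k) bracket \<Rightarrow> bool" where
  "is_twist w br br' \<longleftrightarrow> (\<exists>\<delta>\<in>Gspd w br. br' = twist w br \<delta>)"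

section \<open>Lie algebras of endomorphisms\<close>

text \<open>The additive structure on maps is the pointwise one of \<open>HOL-Library.Function_Algebras\<close>.\<close>

definition endscale ::
    "'k::field_char_0 \<Rightarrow> (('n, 'k) mpol \<Rightarrow> ('n, 'k) mpol) \<Rightarrow> (('n, 'k) mpol \<Rightarrow> ('n, 'k) mpol)" where
  "endscale c \<delta> = (\<lambda>a. pscale c (\<delta> a))"

definition commutator :: "('a::ab_group_add \<Rightarrow> 'a) \<Rightarrow> ('a \<Rightarrow> 'a) \<Rightarrow> ('a \<Rightarrow> 'a)" where
  "commutator \<delta> \<epsilon> = (\<lambda>a. \<delta> (\<epsilon> a) - \<epsilon> (\<delta> a))"

text \<open>A Lie algebra whose underlying vector space is a subspace \<open>L\<close> of an ambient one.\<close>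

definition lie_algebra_on ::
    "('k::field \<Rightarrow> 'v::ab_group_add \<Rightarrow> 'v) \<Rightarrow> ('v \<Rightarrow> 'v \<Rightarrow> 'v) \<Rightarrow> 'v set \<Rightarrow> bool" where
  "lie_algebra_on scale lb L \<longleftrightarrow>
     vector_space scale \<and> module.subspace scale L \<and>
     (\<forall>x\<in>L. \<forall>y\<in>L. lb x y \<in> L) \<and>
     (\<forall>x\<in>L. \<forall>y\<in>L. \<forall>z\<in>L. lb (x + y) z = lb x z + lb y z \<and> lb z (x + y) = lb z x + lb z y) \<and>
     (\<forall>c. \<forall>x\<in>L. \<forall>y\<in>L. lb (scale c x) y = scale c (lb x y) \<and> lb x (scale c y) = scale c (lb x y)) \<and>
     (\<forall>x\<in>L. lb x x = 0) \<and>
     (\<forall>x\<in>L. \<forall>y\<in>L. \<forall>z\<in>L. lb x (lb y z) + lb y (lb z x) + lb z (lb x y) = 0)"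

definition finite_dimensional_on ::
    "('k::field \<Rightarrow> 'v::ab_group_add \<Rightarrow> 'v) \<Rightarrow> 'v set \<Rightarrow> bool" where
  "finite_dimensional_on scale L \<longleftrightarrow> (\<exists>B. finite B \<and> module.span scale B = L)"

lemma vector_space_pscale: "vector_space (pscale :: 'k::field_char_0 \<Rightarrow> ('n, 'k) mpol \<Rightarrow> _)"
  by unfold_locales
    (simp_all add: pscale_def algebra_simps single_add mult_single flip: mult.assoc)

lemma vector_space_endscale:
  "vector_space (endscale :: 'k::field_char_0 \<Rightarrow> (('n, 'k) mpol \<Rightarrow> ('n, 'k) mpol) \<Rightarrow> _)"
proof -
  interpret vector_space "pscale :: 'k \<Rightarrow> ('n, 'k) mpol \<Rightarrow> _" by (rule vector_space_pscale)
  show ?thesis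
    by unfold_locales
      (auto simp: endscale_def fun_eq_iff scale_right_distrib scale_left_distrib)
qed

end

theory Submission
  imports Defs
begin

text \<open>
  Let \<open>E\<close> be the Euler derivation and \<open>D(a,b) = \<delta>{a,b} - {\<delta>a,b} - {a,\<delta>b}\<close> the biderivation that measures
  how far \<open>\<delta>\<close> is from being Poisson; \<open>\<delta>\<close> is semi-Poisson iff the wedge of \<open>E\<close> and \<open>D\<close> vanishes. In the
  unimodular case the divergence of this identity in one argument gives \<open>D(a,b) div E = 0\<close>, and
  \<open>div E\<close> is the sum of the weights. Twisting by \<open>\<delta>\<close> changes the \<open>D\<close> of
  another \<open>\<phi>\<close> by the wedge of \<open>E\<close> and \<open>[\<phi>, \<delta>]\<close>, which the wedge with \<open>E\<close> kills. Degree \<open>0\<close> derivations commute with \<open>E\<close>, hence their Lie derivatives preserve the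
  condition; they form a finite-dimensional space because each \<open>\<delta>(x\<^sub>i)\<close> lies in the span of the finitely
  many monomials of degree \<open>w i\<close>.
\<close>

section \<open>Derivations of the polynomial ring\<close>

text \<open>General in keys and values, so that it serves both for polynomials, as sums of terms,
  and for exponent vectors, as sums of multiples of unit vectors.\<close>

lemma poly_mapping_add_induct [case_names zero single add]:
  fixes a :: "'a \<Rightarrow>\<^sub>0 'b::comm_monoid_add"
  assumes zero: "P 0"
    and single: "\<And>k v. P (Poly_Mapping.single k v)"
    and add: "\<And>a b. P a \<Longrightarrow> P b \<Longrightarrow> P (a + b)"
  shows "P a"
proof (induction a rule: Poly_Mapping.update_induct)
  case const
  show ?case by (rule zero)
next
  case (update f k v)
  have "Poly_Mapping.update k v f = f + Poly_Mapping.single k v"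
    using update.hyps(1)
    by (auto intro!: poly_mapping_eqI
        simp: lookup_update lookup_add lookup_single in_keys_iff when_def)
  then show ?case
    using add[OF update.IH single] by simp
qed

lemma pscale_simps [simp]:
  "pscale c 0 = 0"
  "pscale c (a + b) = pscale c a + pscale c b"
  "pscale c (a - b) = pscale c a - pscale c b"
  "pscale c (- a) = - pscale c a"
  "pscale c a * b = pscale c (a * b)"
  "a * pscale c b = pscale c (a * b)"
  by (simp_all add: pscale_def algebra_simps)

lemma derivation_iff:
  "derivation \<delta> \<longleftrightarrow> (\<forall>a b. \<delta> (a + b) = \<delta> a + \<delta> b) \<and> (\<forall>c a. \<delta> (pscale c a) = pscale c (\<delta> a))
     \<and> (\<forall>a b. \<delta> (a * b) = \<delta> a * b + a * \<delta> b)"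
  unfolding derivation_def Vector_Spaces.linear_iff using vector_space_pscale by blast

lemma derivationD:
  assumes "derivation \<delta>"
  shows derivation_add: "\<delta> (a + b) = \<delta> a + \<delta> b"
    and derivation_pscale: "\<delta> (pscale c a) = pscale c (\<delta> a)"
    and derivation_mult: "\<delta> (a * b) = \<delta> a * b + a * \<delta> b"
    and derivation_0: "\<delta> 0 = 0"
    and derivation_minus: "\<delta> (- a) = - \<delta> a"
    and derivation_diff: "\<delta> (a - b) = \<delta> a - \<delta> b"
    and derivation_1: "\<delta> 1 = 0"
    and derivation_const: "\<delta> (Poly_Mapping.single 0 c) = 0"
    and derivation_sum: "\<delta> (sum f S) = (\<Sum>s\<in>S. \<delta> (f s))"
    and derivation_of_int: "\<delta> (of_int k * a) = of_int k * \<delta> a"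
proof -
  have add: "\<delta> (a + b) = \<delta> a + \<delta> b" for a b using assms derivation_iff by blast
  have sc: "\<delta> (pscale c a) = pscale c (\<delta> a)" for c a using assms derivation_iff by blast
  have mult: "\<delta> (a * b) = \<delta> a * b + a * \<delta> b" for a b using assms derivation_iff by blast
  interpret additive \<delta> by unfold_locales (rule add)
  have one: "\<delta> 1 = 0" using mult[of 1 1] by simp
  show "\<delta> (a + b) = \<delta> a + \<delta> b" "\<delta> (pscale c a) = pscale c (\<delta> a)"
    "\<delta> (a * b) = \<delta> a * b + a * \<delta> b" "\<delta> 1 = 0" by (fact add sc mult one)+
  show "\<delta> 0 = 0" "\<delta> (- a) = - \<delta> a" "\<delta> (a - b) = \<delta> a - \<delta> b"
    "\<delta> (sum f S) = (\<Sum>s\<in>S. \<delta> (f s))"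
    by (fact zero minus diff sum)+
  show "\<delta> (Poly_Mapping.single 0 c) = 0"
    using sc[of c 1] one by (simp add: pscale_def)
  show "\<delta> (of_int k * a) = of_int k * \<delta> a"
    using sc[of "of_int k" a] by (simp add: pscale_def)
qed

lemma derivation_zero: "derivation (\<lambda>a. 0)"
  by (simp add: derivation_iff)

lemma derivation_plus: "derivation \<delta> \<Longrightarrow> derivation \<epsilon> \<Longrightarrow> derivation (\<lambda>a. \<delta> a + \<epsilon> a)"
  by (simp add: derivation_iff algebra_simps)

lemma derivation_times: "derivation \<delta> \<Longrightarrow> derivation (\<lambda>a. f * \<delta> a)"
  by (simp add: derivation_iff algebra_simps)

lemma derivation_subtract: "derivation \<delta> \<Longrightarrow> derivation \<epsilon> \<Longrightarrow> derivation (\<lambda>a. \<delta> a - \<epsilon> a)"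
  by (simp add: derivation_iff algebra_simps)

lemma derivation_setsum:
  "(\<And>s. s \<in> S \<Longrightarrow> derivation (\<delta> s)) \<Longrightarrow> derivation (\<lambda>a. \<Sum>s\<in>S. \<delta> s a)"
  by (induction S rule: infinite_finite_induct) (auto intro: derivation_zero derivation_plus)

lemma derivation_commutator: "derivation \<delta> \<Longrightarrow> derivation \<epsilon> \<Longrightarrow> derivation (commutator \<delta> \<epsilon>)"
  unfolding derivation_iff[of "commutator \<delta> \<epsilon>"]
  by (simp add: commutator_def derivation_add derivation_pscale derivation_mult algebra_simps)

text \<open>The kernel of a derivation is a subalgebra, and the variables generate the polynomial
  ring.\<close>

lemma derivation_vanishes:
  fixes \<delta> :: "('n, 'k::field_char_0) mpol \<Rightarrow> ('n, 'k) mpol"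
  assumes \<delta>: "derivation \<delta>" and var: "\<And>i. \<delta> (var i) = 0"
  shows "\<delta> a = 0"
proof (induction a rule: poly_mapping_add_induct)
  case (single m c)
  have "\<delta> (Poly_Mapping.single m 1) = 0"
  proof (induction m rule: poly_mapping_add_induct)
    case zero
    then show ?case by (simp add: derivation_1[OF \<delta>])
  next
    case (single i k)
    show ?case
    proof (induction k)
      case (Suc k)
      have "Poly_Mapping.single (Poly_Mapping.single i (Suc k)) (1::'k) =
          var i * Poly_Mapping.single (Poly_Mapping.single i k) 1"
        by (simp add: var_def mult_single flip: single_add)
      then show ?case using Suc by (simp add: derivation_mult[OF \<delta>] var)
    qed (simp add: derivation_1[OF \<delta>])
  next
    case (add m n)
    have "Poly_Mapping.single (m + n) (1::'k) = Poly_Mapping.single m 1 * Poly_Mapping.single n 1"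
      by (simp add: mult_single)
    then show ?case using add by (simp add: derivation_mult[OF \<delta>])
  qed
  moreover have "Poly_Mapping.single m c = pscale c (Poly_Mapping.single m 1)"
    by (simp add: pscale_def mult_single)
  ultimately show ?case
    by (simp add: derivation_pscale[OF \<delta>])
qed (simp_all add: derivationD[OF \<delta>])

lemma derivation_eqI:
  assumes "derivation \<delta>" "derivation \<epsilon>" "\<And>i. \<delta> (var i) = \<epsilon> (var i)"
  shows "\<delta> a = \<epsilon> a"
  using derivation_vanishes[OF derivation_subtract[OF assms(1,2)], of a] assms(3) by simp

section \<open>Partial derivatives as a basis of the derivations\<close>

lemma lookup_partial_deriv:
  fixes a :: "('n, 'k::field_char_0) mpol"
  shows "Poly_Mapping.lookup (partial_deriv i a) m =
    of_nat (Poly_Mapping.lookup m i + 1) * Poly_Mapping.lookup a (m + Poly_Mapping.single i 1)"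
proof -
  \<comment> \<open>Truncated subtraction sends the exponents 0 and 1 of \<open>x_i\<close> both to
    0; the factor \<open>lookup k i\<close> removes the first case, so \<open>m + single i 1\<close>
    is the only monomial that contributes at \<open>m\<close>.\<close>
  have eq: "of_nat (Poly_Mapping.lookup k i) * Poly_Mapping.lookup a k *
        (if k - Poly_Mapping.single i 1 = m then 1 else 0) =
      (if k = m + Poly_Mapping.single i 1
       then of_nat (Poly_Mapping.lookup k i) * Poly_Mapping.lookup a k else 0)" for k
  proof (cases "Poly_Mapping.lookup k i = 0")
    case False
    then have "k - Poly_Mapping.single i 1 + Poly_Mapping.single i 1 = k"
      by (auto intro!: poly_mapping_eqI simp: lookup_add lookup_minus lookup_single when_def)
    then show ?thesis by (auto simp: add_implies_diff)
  qed (auto simp: lookup_add)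
  have "Poly_Mapping.lookup (partial_deriv i a) m =
      (\<Sum>k\<in>Poly_Mapping.keys a. of_nat (Poly_Mapping.lookup k i) * Poly_Mapping.lookup a k *
        (if k - Poly_Mapping.single i 1 = m then 1 else 0))"
    unfolding partial_deriv_def lookup_sum
    by (intro sum.cong) (auto simp: lookup_single when_def)
  also have "\<dots> = (\<Sum>k\<in>Poly_Mapping.keys a. if k = m + Poly_Mapping.single i 1
       then of_nat (Poly_Mapping.lookup k i) * Poly_Mapping.lookup a k else 0)"
    by (simp only: eq)
  also have "\<dots> = of_nat (Poly_Mapping.lookup m i + 1) *
      Poly_Mapping.lookup a (m + Poly_Mapping.single i 1)"
    by (simp add: lookup_add in_keys_iff)
  finally show ?thesis .
qed

lemma partial_deriv_add: "partial_deriv i (a + b) = partial_deriv i a + partial_deriv i b"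
  by (auto intro!: poly_mapping_eqI simp: lookup_partial_deriv lookup_add algebra_simps)

lemma partial_deriv_0 [simp]: "partial_deriv i 0 = 0"
  by (simp add: partial_deriv_def)

lemma partial_deriv_single:
  "partial_deriv i (Poly_Mapping.single m c) =
    Poly_Mapping.single (m - Poly_Mapping.single i 1) (of_nat (Poly_Mapping.lookup m i) * c)"
  by (cases "c = 0") (simp_all add: partial_deriv_def)

lemma derivation_partial_deriv: "derivation (partial_deriv i)"
proof -
  \<comment> \<open>Moving the truncated subtraction past \<open>n\<close> is safe when
    \<open>x_i\<close> occurs in \<open>m\<close>; otherwise both coefficients are 0.\<close>
  have mono: "Poly_Mapping.single (m + n - Poly_Mapping.single i 1) (of_nat (Poly_Mapping.lookup m i) * c) =
      Poly_Mapping.single (m - Poly_Mapping.single i 1 + n) (of_nat (Poly_Mapping.lookup m i) * c)"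
    for m n :: "'a \<Rightarrow>\<^sub>0 nat" and c :: 'b
  proof (cases "Poly_Mapping.lookup m i = 0")
    case False
    then have "m + n - Poly_Mapping.single i 1 = m - Poly_Mapping.single i 1 + n"
      by (auto intro!: poly_mapping_eqI simp: lookup_add lookup_minus lookup_single when_def)
    then show ?thesis by simp
  qed simp
  have mult: "partial_deriv i (a * b) = partial_deriv i a * b + a * partial_deriv i b"
    for a b :: "('a, 'b) mpol"
  proof (induction a rule: poly_mapping_add_induct)
    case (single m c)
    show ?case
    proof (induction b rule: poly_mapping_add_induct)
      case (single n d)
      have "partial_deriv i (Poly_Mapping.single m c * Poly_Mapping.single n d) =
          Poly_Mapping.single (m + n - Poly_Mapping.single i 1) (of_nat (Poly_Mapping.lookup m i) * (c * d)) +
          Poly_Mapping.single (n + m - Poly_Mapping.single i 1) (of_nat (Poly_Mapping.lookup n i) * (c * d))"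
        by (simp add: mult_single partial_deriv_single lookup_add algebra_simps flip: single_add)
      then show ?case
        unfolding mono by (simp add: mult_single partial_deriv_single algebra_simps)
    qed (simp_all add: partial_deriv_add algebra_simps)
  qed (simp_all add: partial_deriv_add algebra_simps)
  have "partial_deriv i (pscale c a) = pscale c (partial_deriv i a)" for c and a :: "('a, 'b) mpol"
    by (simp add: pscale_def mult partial_deriv_single)
  with mult show ?thesis
    by (simp add: derivation_iff partial_deriv_add)
qed

lemma partial_deriv_var: "partial_deriv i (var j) = (if i = j then 1 else 0)"
  by (auto simp: var_def partial_deriv_single lookup_single when_def)

text \<open>Both sides are derivations with the same values at the variables. Divergence
  computations and the finite-dimensionality proof reduce to these values through this
  formula.\<close>

lemma derivation_expand:
  fixes \<delta> :: "('n::finite, 'k::field_char_0) mpol \<Rightarrow> ('n, 'k) mpol"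
  assumes "derivation \<delta>"
  shows "\<delta> a = (\<Sum>i\<in>UNIV. \<delta> (var i) * partial_deriv i a)"
proof (rule derivation_eqI[OF assms])
  show "derivation (\<lambda>a. \<Sum>i\<in>UNIV. \<delta> (var i) * partial_deriv i a)"
    by (intro derivation_setsum derivation_times derivation_partial_deriv)
qed (simp add: partial_deriv_var if_distrib cong: if_cong)

section \<open>Divergence\<close>

lemma divergence_add:
  "divergence (\<lambda>a. \<delta> a + \<epsilon> a) = divergence \<delta> + divergence \<epsilon>"
  by (simp add: divergence_def partial_deriv_add sum.distrib)

lemma divergence_diff:
  "divergence (\<lambda>a. \<delta> a - \<epsilon> a) = divergence \<delta> - divergence \<epsilon>"
  by (simp add: divergence_def derivation_diff[OF derivation_partial_deriv] sum_subtractf)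

lemma divergence_times:
  assumes "derivation \<delta>"
  shows "divergence (\<lambda>a. f * \<delta> a) = f * divergence \<delta> + \<delta> f"
proof -
  have "divergence (\<lambda>a. f * \<delta> a) = (\<Sum>i\<in>UNIV. \<delta> (var i) * partial_deriv i f) + f * divergence \<delta>"
    by (simp add: divergence_def derivation_mult[OF derivation_partial_deriv] sum.distrib
        sum_distrib_left mult.commute)
  then show ?thesis by (simp add: derivation_expand[OF assms, of f])
qed

text \<open>The commutator of \<open>partial_deriv i\<close> and \<open>\<delta>\<close> is a
  derivation; it sends \<open>x_j\<close> to the partial derivative of
  \<open>\<delta> (x_j)\<close>, because \<open>\<delta>\<close> kills the constant
  \<open>partial_deriv i (x_j)\<close>. Expanding it over the partial derivatives gives the
  sum.\<close>

lemma partial_deriv_derivation: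
  fixes \<delta> :: "('n::finite, 'k::field_char_0) mpol \<Rightarrow> ('n, 'k) mpol"
  assumes "derivation \<delta>"
  shows "partial_deriv i (\<delta> a) =
    \<delta> (partial_deriv i a) + (\<Sum>j\<in>UNIV. partial_deriv i (\<delta> (var j)) * partial_deriv j a)"
proof -
  have const: "\<delta> (partial_deriv i (var j)) = 0" for j
    by (simp add: partial_deriv_var derivation_0[OF assms] derivation_1[OF assms])
  show ?thesis
    using derivation_expand[OF derivation_commutator[OF derivation_partial_deriv[of i] assms], of a]
    by (simp add: commutator_def const algebra_simps)
qed

lemma divergence_commutator:
  fixes \<delta> \<epsilon> :: "('n::finite, 'k::field_char_0) mpol \<Rightarrow> ('n, 'k) mpol"
  assumes "derivation \<delta>" "derivation \<epsilon>"
  shows "divergence (commutator \<delta> \<epsilon>) = \<delta> (divergence \<epsilon>) - \<epsilon> (divergence \<delta>)"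
proof -
  \<comment> \<open>\<open>S\<close> is the trace of the product of the two Jacobian matrices. Its
    symmetry makes these terms cancel in the commutator.\<close>
  define S where "S \<delta> \<epsilon> = (\<Sum>i\<in>UNIV. \<Sum>j\<in>UNIV. partial_deriv i (\<delta> (var j)) * partial_deriv j (\<epsilon> (var i)))"
    for \<delta> \<epsilon> :: "('n, 'k) mpol \<Rightarrow> ('n, 'k) mpol"
  have *: "(\<Sum>i\<in>UNIV. partial_deriv i (\<delta> (\<epsilon> (var i)))) = \<delta> (divergence \<epsilon>) + S \<delta> \<epsilon>"
    if "derivation \<delta>" for \<delta> \<epsilon> :: "('n, 'k) mpol \<Rightarrow> ('n, 'k) mpol"
  proof -
    have "(\<Sum>i\<in>UNIV. partial_deriv i (\<delta> (\<epsilon> (var i)))) =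
        (\<Sum>i\<in>UNIV. \<delta> (partial_deriv i (\<epsilon> (var i))) +
          (\<Sum>j\<in>UNIV. partial_deriv i (\<delta> (var j)) * partial_deriv j (\<epsilon> (var i))))"
      by (intro sum.cong refl partial_deriv_derivation that)
    then show ?thesis
      by (simp only: S_def divergence_def sum.distrib derivation_sum[OF that])
  qed
  have "S \<epsilon> \<delta> = (\<Sum>i\<in>UNIV. \<Sum>j\<in>UNIV. partial_deriv j (\<epsilon> (var i)) * partial_deriv i (\<delta> (var j)))"
    unfolding S_def by (rule sum.swap)
  also have "\<dots> = S \<delta> \<epsilon>"
    unfolding S_def by (intro sum.cong refl mult.commute)
  finally have "S \<epsilon> \<delta> = S \<delta> \<epsilon>" .
  moreover have "divergence (commutator \<delta> \<epsilon>) =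
      (\<Sum>i\<in>UNIV. partial_deriv i (\<delta> (\<epsilon> (var i)))) - (\<Sum>i\<in>UNIV. partial_deriv i (\<epsilon> (\<delta> (var i))))"
    by (simp only: divergence_def commutator_def derivation_diff[OF derivation_partial_deriv]
        sum_subtractf)
  ultimately show ?thesis
    by (simp only: *[OF assms(1), of \<epsilon>] *[OF assms(2), of \<delta>] add_diff_cancel_right)
qed

section \<open>The Euler derivation\<close>

lemma lookup_euler: "Poly_Mapping.lookup (euler w a) m = of_int (mdeg w m) * Poly_Mapping.lookup a m"
  by (simp add: euler_def lookup_mapp in_keys_iff when_def)

lemma euler_add: "euler w (a + b) = euler w a + euler w b"
  by (auto intro!: poly_mapping_eqI simp: lookup_euler lookup_add algebra_simps)

lemma euler_0 [simp]: "euler w 0 = 0"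
  by (auto intro!: poly_mapping_eqI simp: lookup_euler)

lemma euler_homogeneous_of:
  assumes "homogeneous_of w d a"
  shows "euler w a = of_int d * a"
proof (cases "a = 0")
  case True
  then show ?thesis by simp
next
  case False
  with assms show ?thesis
    using euler_homogeneous[of w a] hdeg_eq[of w d a] by (auto simp: homogeneous_def)
qed

lemma homogeneous_of_single: "homogeneous_of w (mdeg w m) (Poly_Mapping.single m c)"
  by (simp add: homogeneous_of_def)

lemma mdeg_add: "mdeg w (m + n) = mdeg w m + mdeg w n"
  by (simp add: mdeg_def lookup_add algebra_simps sum.distrib)

lemma mdeg_single: "mdeg w (Poly_Mapping.single i k) = int k * w i"
  by (simp add: mdeg_def lookup_single when_def if_distrib[of int] if_distrib[of "\<lambda>x. x * _"]
      cong: if_cong)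

lemma homogeneous_of_mult:
  "homogeneous_of w d a \<Longrightarrow> homogeneous_of w e b \<Longrightarrow> homogeneous_of w (d + e) (a * b)"
  using keys_mult[of a b] by (fastforce simp: homogeneous_of_def mdeg_add)

lemma homogeneous_of_var: "homogeneous_of w (w i) (var i)"
  using homogeneous_of_single[of w "Poly_Mapping.single i 1" 1] by (simp add: var_def mdeg_single)

lemma homogeneous_of_add:
  "homogeneous_of w d a \<Longrightarrow> homogeneous_of w d b \<Longrightarrow> homogeneous_of w d (a + b)"
  using keys_add[of a b] by (auto simp: homogeneous_of_def)

lemma homogeneous_of_diff:
  "homogeneous_of w d a \<Longrightarrow> homogeneous_of w d b \<Longrightarrow> homogeneous_of w d (a - b)"
  by (auto simp: homogeneous_of_def in_keys_iff lookup_minus)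

lemma homogeneous_of_pscale: "homogeneous_of w d a \<Longrightarrow> homogeneous_of w d (pscale c a)"
  using homogeneous_of_mult[of w 0 "Poly_Mapping.single 0 c" d a] homogeneous_of_single[of w 0 c]
  by (simp add: pscale_def mdeg_def)

text \<open>On two monomials the Leibniz rule is additivity of degrees; additivity in each factor
  extends it. Scalars have degree 0, so linearity follows from the Leibniz rule.\<close>

lemma derivation_euler: "derivation (euler w)"
proof -
  have mult: "euler w (a * b) = euler w a * b + a * euler w b" for a b :: "('a, 'b) mpol"
  proof (induction a rule: poly_mapping_add_induct)
    case (single m c)
    show ?case
    proof (induction b rule: poly_mapping_add_induct)
      case (single n d)
      show ?case
        using homogeneous_of_mult[OF homogeneous_of_single homogeneous_of_single, of w m n c d]
        by (simp add: euler_homogeneous_of[OF homogeneous_of_single] euler_homogeneous_of algebra_simps)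
    qed (simp_all add: euler_add algebra_simps)
  qed (simp_all add: euler_add algebra_simps)
  have "euler w (Poly_Mapping.single 0 c) = 0" for c :: 'b
    using euler_homogeneous_of[OF homogeneous_of_single, of w 0 c] by (simp add: mdeg_def)
  then have "euler w (pscale c a) = pscale c (euler w a)" for c and a :: "('a, 'b) mpol"
    by (simp add: pscale_def mult)
  with mult show ?thesis
    by (simp add: derivation_iff euler_add)
qed

lemma euler_var: "euler w (var i) = of_int (w i) * var i"
  by (rule euler_homogeneous_of[OF homogeneous_of_var])

lemma divergence_euler: "divergence (euler w) = of_int (\<Sum>i\<in>UNIV. w i)"
  by (simp add: divergence_def euler_var derivation_of_int[OF derivation_partial_deriv] partial_deriv_var)

text \<open>The commutator is a derivation, so the variables suffice, and there
  \<open>\<delta> (x_i)\<close> again has degree \<open>w i\<close>.\<close>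

lemma derivation_euler_commute:
  assumes \<delta>: "derivation \<delta>" and deg: "graded_deg0 w \<delta>"
  shows "\<delta> (euler w a) = euler w (\<delta> a)"
proof -
  have "euler w (\<delta> (var i)) = of_int (w i) * \<delta> (var i)" for i
    using deg homogeneous_of_var by (intro euler_homogeneous_of) (auto simp: graded_deg0_def)
  then have "commutator \<delta> (euler w) (var i) = 0" for i
    by (simp add: commutator_def euler_var derivation_of_int[OF \<delta>])
  then have "commutator \<delta> (euler w) a = 0"
    by (rule derivation_vanishes[OF derivation_commutator[OF \<delta> derivation_euler]])
  then show ?thesis by (simp add: commutator_def)
qed

section \<open>Degrees of divergences and consequences of positive weights\<close>

lemma homogeneous_of_0: "homogeneous_of w d 0"
  by (simp add: homogeneous_of_def)

lemma homogeneous_of_sum: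
  "(\<And>s. s \<in> S \<Longrightarrow> homogeneous_of w d (f s)) \<Longrightarrow> homogeneous_of w d (sum f S)"
  by (induction S rule: infinite_finite_induct)
    (auto intro: homogeneous_of_add simp: homogeneous_of_0)

lemma homogeneous_of_partial_deriv:
  assumes "homogeneous_of w d a"
  shows "homogeneous_of w (d - w i) (partial_deriv i a)"
  unfolding homogeneous_of_def
proof
  fix m assume "m \<in> Poly_Mapping.keys (partial_deriv i a)"
  then have "m + Poly_Mapping.single i 1 \<in> Poly_Mapping.keys a"
    by (auto simp: in_keys_iff lookup_partial_deriv)
  then have "mdeg w (m + Poly_Mapping.single i 1) = d"
    using assms by (auto simp: homogeneous_of_def)
  then show "mdeg w m = d - w i" by (simp add: mdeg_add mdeg_single)
qed

text \<open>The polynomial \<open>\<delta> (x_i)\<close> has degree \<open>w i\<close>, and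
  differentiating by \<open>x_i\<close> lowers the degree by exactly \<open>w i\<close>.\<close>

lemma homogeneous_of_divergence:
  "graded_deg0 w \<delta> \<Longrightarrow> homogeneous_of w 0 (divergence \<delta>)"
  unfolding divergence_def graded_deg0_def
  using homogeneous_of_partial_deriv[OF _ , of w "w i" "\<delta> (var i)" i for i] homogeneous_of_var
  by (intro homogeneous_of_sum) fastforce

lemma homogeneous_of_0_const:
  assumes pos: "\<forall>i. w i > 0" and hom: "homogeneous_of w 0 a"
  shows "a = Poly_Mapping.single 0 (Poly_Mapping.lookup a 0)"
proof (rule poly_mapping_eqI)
  fix m
  have "m = 0" if "m \<in> Poly_Mapping.keys a"
  proof -
    have "(\<Sum>i\<in>UNIV. int (Poly_Mapping.lookup m i) * w i) = 0"
      using hom that by (simp add: homogeneous_of_def mdeg_def)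
    moreover have "0 \<le> int (Poly_Mapping.lookup m i) * w i" for i
      using pos by (simp add: order_less_imp_le)
    ultimately have "int (Poly_Mapping.lookup m i) * w i = 0" for i
      by (simp add: sum_nonneg_eq_0_iff)
    then show "m = 0"
      using pos by (auto intro!: poly_mapping_eqI simp: order_less_imp_not_eq2)
  qed
  then show "Poly_Mapping.lookup a m =
      Poly_Mapping.lookup (Poly_Mapping.single 0 (Poly_Mapping.lookup a 0)) m"
    by (cases "m = 0") (auto simp: lookup_single in_keys_iff)
qed

lemma finite_mdeg:
  fixes w :: "'n::finite \<Rightarrow> int"
  assumes pos: "\<forall>i. w i > 0"
  shows "finite {m. mdeg w m = d}"
proof (rule finite_imageD)
  \<comment> \<open>Integer weights are at least 1, so every exponent is bounded by the degree and
    the exponent vectors lie in a finite box.\<close>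
  have le: "Poly_Mapping.lookup m i \<le> nat (mdeg w m)" for m :: "'n \<Rightarrow>\<^sub>0 nat" and i
  proof -
    have w: "1 \<le> w j" for j using pos by (simp add: int_one_le_iff_zero_less)
    have "int (Poly_Mapping.lookup m i) * 1 \<le> int (Poly_Mapping.lookup m i) * w i"
      using w by (intro mult_left_mono) auto
    also have "\<dots> \<le> mdeg w m"
      unfolding mdeg_def using pos by (intro member_le_sum) (simp_all add: order_less_imp_le)
    finally show ?thesis by simp
  qed
  have "finite {f :: 'n \<Rightarrow> nat. \<forall>x. (x \<in> UNIV \<longrightarrow> f x \<in> {..nat d}) \<and> (x \<notin> UNIV \<longrightarrow> f x = 0)}"
    by (rule finite_set_of_finite_funs) auto
  then show "finite (Poly_Mapping.lookup ` {m. mdeg w m = d})"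
    by (rule rev_finite_subset) (use le in auto)
  show "inj_on Poly_Mapping.lookup {m. mdeg w m = d}"
    by (simp add: inj_on_def lookup_inject)
qed

section \<open>The defect of a derivation with respect to a bracket\<close>

text \<open>This is the Lie derivative of the bracket along \<open>\<delta>\<close>.\<close>

definition defect :: "('n, 'k::field_char_0) bracket \<Rightarrow> (('n, 'k) mpol \<Rightarrow> ('n, 'k) mpol) \<Rightarrow>
    ('n, 'k) bracket" where
  "defect br \<delta> a b = \<delta> (br a b) - br (\<delta> a) b - br a (\<delta> b)"

text \<open>The exterior product of the vector field \<open>E\<close> with a skew biderivation
  \<open>D\<close>. With \<open>euler\<close> in place of \<open>hdeg\<close> it makes sense for
  inhomogeneous arguments.\<close>

definition euler_wedge :: "('n::finite \<Rightarrow> int) \<Rightarrow> ('n, 'k::field_char_0) bracket \<Rightarrow>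
    ('n, 'k) mpol \<Rightarrow> ('n, 'k) mpol \<Rightarrow> ('n, 'k) mpol \<Rightarrow> ('n, 'k) mpol" where
  "euler_wedge w D a b c = euler w a * D b c - euler w b * D a c + euler w c * D a b"

lemma p_form_eq:
  assumes "homogeneous w a" "homogeneous w b" "homogeneous w c"
  shows "p_form w br \<delta> a b c = euler_wedge w (defect br \<delta>) a b c"
  by (simp add: p_form_def euler_wedge_def defect_def assms euler_homogeneous)

lemma Poisson_bracketD:
  assumes "Poisson_bracket br"
  shows derivation_bracket: "derivation (br a)"
    and derivation_bracket_left: "derivation (\<lambda>a. br a b)"
    and bracket_skew: "br b a = - br a b"
proof -
  show right: "derivation (br a)" and left: "derivation (\<lambda>a. br a b)" for a b
    using assms by (auto simp: Poisson_bracket_def)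
  have alt: "br a a = 0" for a
    using assms by (auto simp: Poisson_bracket_def)
  have "br (a + b) (a + b) = br a b + br b a"
    using derivation_add[OF left, of a b "a + b"] by (simp add: derivation_add[OF right] alt)
  then show "br b a = - br a b"
    by (simp add: alt eq_neg_iff_add_eq_0 add.commute)
qed

text \<open>Written this way, \<open>D(a,-)\<close> is a difference of derivations, to which the
  divergence formula for commutators applies.\<close>

lemma defect_eq_commutator: "defect br \<delta> a = (\<lambda>b. commutator \<delta> (br a) b - br (\<delta> a) b)"
  by (simp add: fun_eq_iff defect_def commutator_def)

lemma derivation_defect:
  "Poisson_bracket br \<Longrightarrow> derivation \<delta> \<Longrightarrow> derivation (defect br \<delta> a)"
  unfolding defect_eq_commutator
  by (rule derivation_subtract[OF derivation_commutator]) (simp_all add: derivation_bracket)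

lemma defect_skew:
  assumes "Poisson_bracket br" "derivation \<delta>"
  shows "defect br \<delta> b a = - defect br \<delta> a b"
  using bracket_skew[OF assms(1), of b a] bracket_skew[OF assms(1), of b "\<delta> a"]
    bracket_skew[OF assms(1), of "\<delta> b" a]
  by (simp add: defect_def derivation_minus[OF assms(2)])

lemma derivation_defect_left:
  assumes "Poisson_bracket br" "derivation \<delta>"
  shows "derivation (\<lambda>a. defect br \<delta> a b)"
proof -
  have "(\<lambda>a. defect br \<delta> a b) = (\<lambda>a. (- 1) * defect br \<delta> b a)"
    by (subst defect_skew[OF assms]) simp
  then show ?thesis
    using derivation_times[OF derivation_defect[OF assms]] by presburger
qed

text \<open>The wedge is additive in each argument, and every polynomial is a sum of terms, which
  are homogeneous. The identity thereby becomes available for arbitrary arguments.\<close>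

lemma semi_Poisson_iff:
  assumes br: "Poisson_bracket br" and \<delta>: "derivation \<delta>"
  shows "semi_Poisson w br \<delta> \<longleftrightarrow> (\<forall>a b c. euler_wedge w (defect br \<delta>) a b c = 0)"
proof
  assume semi: "semi_Poisson w br \<delta>"
  have add: "euler_wedge w (defect br \<delta>) (a + a') b c =
      euler_wedge w (defect br \<delta>) a b c + euler_wedge w (defect br \<delta>) a' b c"
    "euler_wedge w (defect br \<delta>) b (a + a') c =
      euler_wedge w (defect br \<delta>) b a c + euler_wedge w (defect br \<delta>) b a' c"
    "euler_wedge w (defect br \<delta>) b c (a + a') =
      euler_wedge w (defect br \<delta>) b c a + euler_wedge w (defect br \<delta>) b c a'" for a a' b c
    by (simp_all add: euler_wedge_def euler_add algebra_simps
        derivation_add[OF derivation_defect[OF br \<delta>]] derivation_add[OF derivation_defect_left[OF br \<delta>]])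
  have zero: "euler_wedge w (defect br \<delta>) 0 b c = 0" "euler_wedge w (defect br \<delta>) b 0 c = 0"
    "euler_wedge w (defect br \<delta>) b c 0 = 0" for b c
    by (simp_all add: euler_wedge_def
        derivation_0[OF derivation_defect[OF br \<delta>]] derivation_0[OF derivation_defect_left[OF br \<delta>]])
  have hom: "homogeneous w (Poly_Mapping.single m c)" for m and c :: 'b
    using homogeneous_of_single unfolding homogeneous_def by blast
  show "\<forall>a b c. euler_wedge w (defect br \<delta>) a b c = 0"
  proof (intro allI)
    fix a b c
    show "euler_wedge w (defect br \<delta>) a b c = 0"
    proof (induction a rule: poly_mapping_add_induct)
      case (single m u)
      show ?case
      proof (induction b rule: poly_mapping_add_induct)
        case (single n v)
        show ?case
        proof (induction c rule: poly_mapping_add_induct)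
          case (single l t)
          then show ?case
            using semi by (simp add: semi_Poisson_def hom flip: p_form_eq)
        qed (simp_all add: add zero)
      qed (simp_all add: add zero)
    qed (simp_all add: add zero)
  qed
qed (simp add: semi_Poisson_def p_form_eq)

lemma semi_Poisson_Poisson_derivation: "Poisson_derivation br \<delta> \<Longrightarrow> semi_Poisson w br \<delta>"
  by (simp add: semi_Poisson_def Poisson_derivation_def p_form_def)

lemma Gspd_D:
  assumes "\<delta> \<in> Gspd w br"
  shows "derivation \<delta>" "graded_deg0 w \<delta>" "semi_Poisson w br \<delta>"
  using assms by (auto simp: Gspd_def)

text \<open>The bracket adds degrees, so on monomials both sides equal the bracket times the sum of
  the two degrees.\<close>

lemma euler_bracket:
  assumes "graded_Poisson_algebra w br"
  shows "euler w (br a b) = br (euler w a) b + br a (euler w b)"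
proof -
  have br: "Poisson_bracket br"
    using assms by (simp add: graded_Poisson_algebra_def)
  note right = derivation_bracket[OF br] and left = derivation_bracket_left[OF br]
  show ?thesis
  proof (induction a rule: poly_mapping_add_induct)
    case (single m c)
    show ?case
    proof (induction b rule: poly_mapping_add_induct)
      case (single n d)
      let ?a = "Poly_Mapping.single m c" and ?b = "Poly_Mapping.single n d"
      have "homogeneous_of w (mdeg w m + mdeg w n) (br ?a ?b)"
        using assms homogeneous_of_single unfolding graded_Poisson_algebra_def by blast
      then show ?case
        by (simp add: euler_homogeneous_of euler_homogeneous_of[OF homogeneous_of_single]
            derivation_of_int[OF left] derivation_of_int[OF right] distrib_right)
    qed (simp_all add: euler_add derivation_add[OF right] derivation_0[OF right])
  qed (simp_all add: euler_add derivation_add[OF left] derivation_0[OF left])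
qed

text \<open>\<open>E\<close> is a Poisson derivation and commutes with \<open>\<delta>\<close>, so
  it passes through each term of the defect.\<close>

lemma euler_defect:
  assumes gr: "graded_Poisson_algebra w br" and \<delta>: "derivation \<delta>" "graded_deg0 w \<delta>"
  shows "euler w (defect br \<delta> a b) = defect br \<delta> (euler w a) b + defect br \<delta> a (euler w b)"
  by (simp add: defect_def derivation_diff[OF derivation_euler] euler_bracket[OF gr]
      derivation_euler_commute[OF \<delta>] derivation_add[OF \<delta>(1)] flip: derivation_euler_commute[OF \<delta>])

section \<open>The unimodular case\<close>

text \<open>Read as a derivation in its last argument, \<open>E(a) D(b,-) - E(b) D(a,-) + D(a,b) E\<close> vanishes;
  its divergence is \<open>D(a,b) div E\<close>, because the defect \<open>D(a,-)\<close> is divergence free.\<close>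

lemma unimodular_semi_Poisson:
  fixes w :: "'n::finite \<Rightarrow> int" and br :: "('n, 'k::field_char_0) bracket"
  assumes gr: "graded_Poisson_algebra w br" and pos: "\<forall>i. w i > 0"
    and uni: "unimodular br" and \<delta>: "\<delta> \<in> Gspd w br"
  shows "defect br \<delta> a b = 0"
proof -
  note \<delta> = Gspd_D[OF \<delta>]
  have br: "Poisson_bracket br"
    using gr by (simp add: graded_Poisson_algebra_def)
  note D = derivation_defect[OF br \<delta>(1)]
  have ham: "divergence (br a) = 0" for a
    using uni by (simp add: unimodular_def modular_derivation_def)
  \<comment> \<open>By the commutator formula only the bracket of \<open>a\<close> with
    \<open>divergence \<delta>\<close> could survive. That divergence has degree 0, hence is a
    constant by positivity of the weights, and is killed.\<close>
  have div_D: "divergence (defect br \<delta> a) = 0" for a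
  proof -
    have "br a (divergence \<delta>) = 0"
      using homogeneous_of_0_const[OF pos homogeneous_of_divergence[OF \<delta>(2)]]
        derivation_const[OF derivation_bracket[OF br]] by metis
    then show ?thesis
      unfolding defect_eq_commutator divergence_diff
      by (simp add: divergence_commutator[OF \<delta>(1) derivation_bracket[OF br]] ham derivation_0[OF \<delta>(1)])
  qed
  have "(\<lambda>c. euler w a * defect br \<delta> b c - euler w b * defect br \<delta> a c + defect br \<delta> a b * euler w c)
      = (\<lambda>c. 0)"
    using \<delta>(3) unfolding semi_Poisson_iff[OF br \<delta>(1)] euler_wedge_def by (simp add: mult.commute)
  then have "divergence (\<lambda>c. euler w a * defect br \<delta> b c - euler w b * defect br \<delta> a c
      + defect br \<delta> a b * euler w c) = divergence (\<lambda>c. 0 :: ('n, 'k) mpol)"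
    by simp
  also have "\<dots> = 0"
    by (simp add: divergence_def)
  finally have "defect br \<delta> b (euler w a) - defect br \<delta> a (euler w b)
      + (defect br \<delta> a b * of_int (\<Sum>i\<in>UNIV. w i) + euler w (defect br \<delta> a b)) = 0"
    by (simp add: divergence_add divergence_diff divergence_times[OF D]
        divergence_times[OF derivation_euler] div_D divergence_euler del: of_int_sum)
  \<comment> \<open>Skew symmetry turns \<open>D(b, E a)\<close> into \<open>- D(E a, b)\<close>;
    expanding \<open>E (D(a,b))\<close> by \<open>euler_defect\<close> then cancels everything
    except the multiple of \<open>D(a,b)\<close>.\<close>
  then have *: "of_int (\<Sum>i\<in>UNIV. w i) * defect br \<delta> a b = 0"
    using defect_skew[OF br \<delta>(1), of b "euler w a"]
    by (simp add: euler_defect[OF gr \<delta>(1,2)] mult.commute del: of_int_sum)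
  have "(\<Sum>i\<in>UNIV. w i) > 0"
    using pos by (intro sum_pos) auto
  then have "(of_int (\<Sum>i\<in>UNIV. w i) :: 'k) \<noteq> 0"
    by (simp del: of_int_sum)
  \<comment> \<open>The sum of the weights is a nonzero constant in characteristic zero, so it can
    be inverted in the field.\<close>
  then have "defect br \<delta> a b = Poly_Mapping.single 0 (inverse (of_int (\<Sum>i\<in>UNIV. w i))) *
      (of_int (\<Sum>i\<in>UNIV. w i) * defect br \<delta> a b)"
    by (simp add: mult_single flip: mult.assoc single_of_int del: of_int_sum single_of_int)
  with * show ?thesis by simp
qed

lemma unimodular_Gspd:
  assumes "graded_Poisson_algebra w br" "\<forall>i. w i > 0" "unimodular br"
  shows "Gspd w br = Gpd w br"
proof
  show "Gpd w br \<subseteq> Gspd w br"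
    using semi_Poisson_Poisson_derivation by (auto simp: Gspd_def Gpd_def)
  show "Gspd w br \<subseteq> Gpd w br"
  proof
    fix \<delta> assume \<delta>: "\<delta> \<in> Gspd w br"
    have "Poisson_derivation br \<delta>"
      using unimodular_semi_Poisson[OF assms \<delta>]
      by (simp add: Poisson_derivation_def defect_def algebra_simps)
    with \<delta> show "\<delta> \<in> Gpd w br" by (simp add: Gspd_def Gpd_def)
  qed
qed

section \<open>Twists\<close>

lemma euler_wedge_twist:
  assumes \<phi>: "derivation \<phi>" "graded_deg0 w \<phi>"
  shows "euler_wedge w (defect (twist w br \<delta>) \<phi>) a b c = euler_wedge w (defect br \<phi>) a b c"
proof -
  \<comment> \<open>Since \<open>\<phi>\<close> commutes with \<open>E\<close>, the Leibniz terms in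
    which \<open>\<phi>\<close> hits the Euler factor cancel against the twist at
    \<open>\<phi> a\<close> or \<open>\<phi> b\<close>. What remains contains a factor
    \<open>E\<close> and dies in a further wedge with \<open>E\<close>.\<close>
  have "defect (twist w br \<delta>) \<phi> a b =
      defect br \<phi> a b + euler w a * commutator \<phi> \<delta> b - commutator \<phi> \<delta> a * euler w b" for a b
    by (simp add: defect_def twist_def commutator_def derivation_add[OF \<phi>(1)]
        derivation_diff[OF \<phi>(1)] derivation_mult[OF \<phi>(1)] derivation_euler_commute[OF \<phi>] algebra_simps)
  then show ?thesis
    by (simp only: euler_wedge_def) (simp add: algebra_simps)
qed

text \<open>The comparison is made on homogeneous arguments through \<open>p_form_eq\<close>, which
  is valid for every bracket, the twisted one included.\<close>

lemma Gspd_twist: "Gspd w (twist w br \<delta>) = Gspd w br"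
  unfolding Gspd_def semi_Poisson_def
  by (auto simp: p_form_eq euler_wedge_twist)

section \<open>The Lie algebra of semi-Poisson derivations\<close>

lemma commutator_Gspd:
  assumes br: "Poisson_bracket br" and \<phi>: "\<phi> \<in> Gspd w br" and \<psi>: "\<psi> \<in> Gspd w br"
  shows "commutator \<phi> \<psi> \<in> Gspd w br"
proof -
  note \<phi> = Gspd_D[OF \<phi>] and \<psi> = Gspd_D[OF \<psi>]
  \<comment> \<open>\<open>L \<phi> \<psi>\<close> is the Lie derivative along \<open>\<phi>\<close>
    of the defect of \<open>\<psi>\<close>.\<close>
  define L where "L \<phi> \<psi> a b = \<phi> (defect br \<psi> a b) - defect br \<psi> (\<phi> a) b - defect br \<psi> a (\<phi> b)"
    for \<phi> \<psi> :: "('a, 'b) mpol \<Rightarrow> ('a, 'b) mpol" and a b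
  have L: "euler_wedge w (L \<phi> \<psi>) a b c = 0" if \<phi>: "\<phi> \<in> Gspd w br" and \<psi>: "\<psi> \<in> Gspd w br" for \<phi> \<psi> a b c
  proof -
    note \<phi> = Gspd_D[OF \<phi>] and \<psi> = Gspd_D[OF \<psi>]
    have 0: "euler_wedge w (defect br \<psi>) a b c = 0" for a b c
      using \<psi>(3) semi_Poisson_iff[OF br \<psi>(1)] by blast
    \<comment> \<open>The Lie derivative obeys the Leibniz rule for the wedge, and its term on
      \<open>E\<close> vanishes because \<open>\<phi>\<close> commutes with
      \<open>E\<close>.\<close>
    have "euler_wedge w (L \<phi> \<psi>) a b c = \<phi> (euler_wedge w (defect br \<psi>) a b c)
        - euler_wedge w (defect br \<psi>) (\<phi> a) b c - euler_wedge w (defect br \<psi>) a (\<phi> b) c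
        - euler_wedge w (defect br \<psi>) a b (\<phi> c)"
      by (simp add: euler_wedge_def L_def derivation_add[OF \<phi>(1)] derivation_diff[OF \<phi>(1)]
          derivation_mult[OF \<phi>(1)] derivation_euler_commute[OF \<phi>(1,2)] algebra_simps)
    then show ?thesis by (simp add: 0 derivation_0[OF \<phi>(1)])
  qed
  \<comment> \<open>The Lie derivative along a commutator is the commutator of the Lie
    derivatives.\<close>
  have "defect br (commutator \<phi> \<psi>) a b = L \<phi> \<psi> a b - L \<psi> \<phi> a b" for a b
    by (simp add: L_def defect_def commutator_def derivation_diff[OF \<phi>(1)] derivation_diff[OF \<psi>(1)]
        derivation_diff[OF derivation_bracket[OF br]] derivation_diff[OF derivation_bracket_left[OF br]])
  then have "euler_wedge w (defect br (commutator \<phi> \<psi>)) a b c =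
      euler_wedge w (L \<phi> \<psi>) a b c - euler_wedge w (L \<psi> \<phi>) a b c" for a b c
    by (simp only: euler_wedge_def) (simp add: algebra_simps)
  then have "semi_Poisson w br (commutator \<phi> \<psi>)"
    using assms by (simp add: semi_Poisson_def p_form_eq L)
  moreover have "graded_deg0 w (commutator \<phi> \<psi>)"
    using \<phi>(2) \<psi>(2) by (simp add: graded_deg0_def commutator_def homogeneous_of_diff)
  ultimately show ?thesis
    using derivation_commutator[OF \<phi>(1) \<psi>(1)] by (simp add: Gspd_def)
qed

text \<open>All conditions are linear in the derivation; in particular \<open>p_form\<close>
  is.\<close>

lemma subspace_Gspd:
  assumes br: "Poisson_bracket br"
  shows "module.subspace endscale (Gspd w br)"
proof -
  interpret vector_space "endscale :: 'b \<Rightarrow> (('a, 'b) mpol \<Rightarrow> ('a, 'b) mpol) \<Rightarrow> _"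
    by (rule vector_space_endscale)
  note right = derivation_bracket[OF br] and left = derivation_bracket_left[OF br]
  show ?thesis
  proof (rule subspaceI)
    have "semi_Poisson w br (\<lambda>a. 0)"
      by (simp add: semi_Poisson_def p_form_def derivation_0[OF right] derivation_0[OF left])
    moreover have "graded_deg0 w (\<lambda>a. 0)"
      by (simp add: graded_deg0_def homogeneous_of_def)
    ultimately show "0 \<in> Gspd w br"
      by (simp add: Gspd_def zero_fun_def derivation_zero)
  next
    fix \<phi> \<psi> assume \<phi>: "\<phi> \<in> Gspd w br" and \<psi>: "\<psi> \<in> Gspd w br"
    note \<phi> = Gspd_D[OF \<phi>] and \<psi> = Gspd_D[OF \<psi>]
    have "p_form w br (\<lambda>a. \<phi> a + \<psi> a) a b c = p_form w br \<phi> a b c + p_form w br \<psi> a b c" for a b c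
      by (simp add: p_form_def derivation_add[OF right] derivation_add[OF left] algebra_simps)
    then have "semi_Poisson w br (\<lambda>a. \<phi> a + \<psi> a)"
      using \<phi>(3) \<psi>(3) by (simp add: semi_Poisson_def)
    then show "\<phi> + \<psi> \<in> Gspd w br"
      using \<phi> \<psi> by (simp add: Gspd_def plus_fun_def derivation_plus graded_deg0_def homogeneous_of_add)
  next
    fix c \<phi> assume \<phi>: "\<phi> \<in> Gspd w br"
    note \<phi> = Gspd_D[OF \<phi>]
    have "p_form w br (endscale k \<phi>) a b c = pscale k (p_form w br \<phi> a b c)" for k a b c
      by (simp add: p_form_def endscale_def derivation_pscale[OF right] derivation_pscale[OF left]
          algebra_simps)
    then have "semi_Poisson w br (endscale c \<phi>)"
      using \<phi>(3) by (simp add: semi_Poisson_def)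
    moreover have "derivation (endscale c \<phi>)"
      unfolding endscale_def pscale_def by (rule derivation_times[OF \<phi>(1)])
    ultimately show "endscale c \<phi> \<in> Gspd w br"
      using \<phi>(2) by (simp add: Gspd_def graded_deg0_def endscale_def homogeneous_of_pscale)
  qed
qed

text \<open>Elements of \<open>Gspd\<close> are linear maps, so bilinearity and the Jacobi identity
  can be checked pointwise by expanding compositions.\<close>

lemma lie_algebra_Gspd:
  assumes br: "Poisson_bracket br"
  shows "lie_algebra_on endscale commutator (Gspd w br)"
  unfolding lie_algebra_on_def
  using vector_space_endscale subspace_Gspd[OF br] commutator_Gspd[OF br]
  by (auto simp: commutator_def fun_eq_iff endscale_def algebra_simps
      dest!: Gspd_D(1) simp: derivation_add derivation_diff derivation_pscale)

section \<open>Finite dimensionality\<close>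

lemma sum_fun_apply: "(\<Sum>s\<in>S. f s) a = (\<Sum>s\<in>S. f s a)"
  by (induction S rule: infinite_finite_induct) auto

lemma mpol_sum_monomials:
  "p = (\<Sum>m\<in>Poly_Mapping.keys p. pscale (Poly_Mapping.lookup p m) (Poly_Mapping.single m 1))"
  by (auto intro!: poly_mapping_eqI
      simp: pscale_def mult_single lookup_sum lookup_single when_def in_keys_iff)

lemma finite_dimensional_Gspd:
  fixes w :: "'n::finite \<Rightarrow> int" and br :: "('n, 'k::field_char_0) bracket"
  assumes br: "Poisson_bracket br" and pos: "\<forall>i. w i > 0"
  shows "finite_dimensional_on endscale (Gspd w br)"
proof -
  interpret vector_space "endscale :: 'k \<Rightarrow> (('n, 'k) mpol \<Rightarrow> ('n, 'k) mpol) \<Rightarrow> _"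
    by (rule vector_space_endscale)
  \<comment> \<open>\<open>e i m\<close> is the monomial vector field with coefficient
    \<open>m\<close> in direction \<open>i\<close>; it has degree 0 when \<open>m\<close> has degree
    \<open>w i\<close>, and positivity of the weights leaves finitely many of these.\<close>
  define e :: "'n \<Rightarrow> ('n \<Rightarrow>\<^sub>0 nat) \<Rightarrow> ('n, 'k) mpol \<Rightarrow> ('n, 'k) mpol"
    where "e i m = (\<lambda>a. Poly_Mapping.single m 1 * partial_deriv i a)" for i m
  define T where "T = (\<Union>i. e i ` {m. mdeg w m = w i})"
  have fin: "finite T"
    unfolding T_def by (intro finite_UN_I finite_imageI finite_mdeg pos) simp
  have "Gspd w br \<subseteq> span T"
  proof
    fix \<delta> assume \<delta>: "\<delta> \<in> Gspd w br"
    note \<delta> = Gspd_D[OF \<delta>]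
    have "\<delta> a = (\<Sum>i\<in>UNIV. \<Sum>m\<in>Poly_Mapping.keys (\<delta> (var i)).
        endscale (Poly_Mapping.lookup (\<delta> (var i)) m) (e i m)) a" for a
    proof -
      have "\<delta> a = (\<Sum>i\<in>UNIV. \<delta> (var i) * partial_deriv i a)"
        by (rule derivation_expand[OF \<delta>(1)])
      also have "\<dots> = (\<Sum>i\<in>UNIV. (\<Sum>m\<in>Poly_Mapping.keys (\<delta> (var i)).
          pscale (Poly_Mapping.lookup (\<delta> (var i)) m) (Poly_Mapping.single m 1)) * partial_deriv i a)"
        by (intro sum.cong refl arg_cong2[where f = times] mpol_sum_monomials)
      finally show ?thesis
        by (simp add: sum_fun_apply endscale_def e_def sum_distrib_right)
    qed
    then have "\<delta> = (\<Sum>i\<in>UNIV. \<Sum>m\<in>Poly_Mapping.keys (\<delta> (var i)).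
        endscale (Poly_Mapping.lookup (\<delta> (var i)) m) (e i m))"
      by blast
    moreover have "mdeg w m = w i" if "m \<in> Poly_Mapping.keys (\<delta> (var i))" for i m
      using \<delta>(2) homogeneous_of_var that unfolding graded_deg0_def homogeneous_of_def by blast
    then have "(\<Sum>i\<in>UNIV. \<Sum>m\<in>Poly_Mapping.keys (\<delta> (var i)).
        endscale (Poly_Mapping.lookup (\<delta> (var i)) m) (e i m)) \<in> span T"
      by (intro span_sum span_scale span_base) (auto simp: T_def)
    ultimately show "\<delta> \<in> span T" by simp
  qed
  \<comment> \<open>The elements of \<open>T\<close> need not be semi-Poisson, so \<open>T\<close>
    only bounds the dimension; a basis chosen inside \<open>Gspd w br\<close> has exactly this
    span.\<close>
  moreover obtain B where B: "B \<subseteq> Gspd w br" "independent B" "Gspd w br \<subseteq> span B"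
    by (rule maximal_independent_subset)
  ultimately have "finite B"
    using independent_span_bound[OF fin B(2)] by blast
  moreover have "span B = Gspd w br"
    using B span_minimal[OF B(1) subspace_Gspd[OF br]] by blast
  ultimately show ?thesis
    unfolding finite_dimensional_on_def by blast
qed

theorem theorem0p5:
  fixes w :: "'n::finite \<Rightarrow> int"
    and br :: "('n, 'k::field_char_0) bracket"
  assumes "graded_Poisson_algebra w br"
    and "\<forall>i. w i > 0"
  shows "(unimodular br \<longrightarrow> Gspd w br = Gpd w br)
    \<and> (\<forall>br'. is_twist w br br' \<longrightarrow> Gspd w br = Gspd w br')
    \<and> (lie_algebra_on endscale commutator (Gspd w br)
        \<and> finite_dimensional_on endscale (Gspd w br))"
proof -
  have "Poisson_bracket br"
    using assms(1) by (simp add: graded_Poisson_algebra_def)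
  then show ?thesis
    using unimodular_Gspd[OF assms] lie_algebra_Gspd finite_dimensional_Gspd[OF _ assms(2)]
    by (auto simp: is_twist_def Gspd_twist)
qed

end
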